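(* Let $p$ be a prime with $p\equiv 1\pmod{12}$ or $p\equiv 7\pmod{12}$, and let $j$ be a positive integer with $j\mid p-1$ and $\mathrm{ord}_p(-3)=\frac{p-1}{j}$. Then the permutations of $\mathbb{F}_p$ induced by $D_{p+2}(1,x)$ and by $D_{2p+1}(1,x)$ both have cycle type $\bigl(\underbrace{\tfrac{p-1}{j},\dots,\tfrac{p-1}{j}}_{\frac{j}{2}\text{ times}},\underbrace{1,\dots,1}_{\frac{p+1}{2}\text{ times}}\bigr)$.
   Context: The $n$th reversed Dickson polynomial of the first kind (with parameter $1$) is the integer-coefficient polynomial $D_n(1,x)$ defined by $D_0(1,x)=2$, $D_1(1,x)=1$, $D_n(1,x)=D_{n-1}(1,x)-x\,D_{n-2}(1,x)$ for $n\ge 2$. Coefficients are reduced modulo $p$ to regard it as a polynomial over $\mathbb{F}_p$. For an integer $a$ prime to $p$, $\mathrm{ord}_p(a)$ is the multiplicative order of $a$ modulo $p$. The cycle type of a permutation of $\mathbb{F}_p$ is the multiset of lengths of the cycles in its disjoint cycle decomposition, fixed points being counted as cycles of length $1$. *)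

theory Defs
  imports
    "HOL-Number_Theory.Number_Theory"
    "HOL-Computational_Algebra.Polynomial"
    "HOL-Combinatorics.Orbits"
    "HOL-Library.Multiset"
begin

text \<open>
  Reversed Dickson polynomials of the first kind \<open>D\<^sub>n(1, x)\<close>, with the parameter fixed to 1.
\<close>

fun rev_dickson :: "nat \<Rightarrow> int poly" where
  "rev_dickson 0 = [:2:]"
| "rev_dickson (Suc 0) = [:1:]"
| "rev_dickson (Suc (Suc n)) = rev_dickson (Suc n) - [:0, 1:] * rev_dickson n"

text \<open>
  The prime field with \<open>p\<close> elements is \<^term>\<open>residue_ring (int p)\<close>, whose elements are the
  representatives \<open>0, \<dots>, p - 1\<close>. An integer polynomial is regarded as a polynomial over this field
  by reducing its coefficients, and then induces the following self-map of the carrier.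
  The values of this function outside the carrier are irrelevant.
\<close>

definition induced_map :: "nat \<Rightarrow> int poly \<Rightarrow> int \<Rightarrow> int" where
  "induced_map p f x = poly (map_poly (\<lambda>c. c mod int p) f) x mod int p"

text \<open>
  For a permutation \<open>f\<close> of a finite set \<open>S\<close>, the cycles of \<open>f\<close> (including those of length 1)
  are its orbits on \<open>S\<close>. The inner set identifies elements of \<open>S\<close> lying in the same cycle, so each
  cycle contributes its length exactly once to the multiset.
\<close>

definition cycle_type :: "('a \<Rightarrow> 'a) \<Rightarrow> 'a set \<Rightarrow> nat multiset" where
  "cycle_type f S = image_mset card (mset_set (orbit f ` S))"

end

theory Submission
  imports Defs
begin

text \<open>
  Put \<open>u = 1 - 4 x\<close>, so that \<open>D\<^sub>n(1, x) = ((1 + s) / 2)\<^sup>n + ((1 - s) / 2)\<^sup>n\<close> with \<open>s\<^sup>2 = u\<close>.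
  Frobenius sends \<open>s\<close> to \<open>\<chi>(u) s\<close>, where \<open>\<chi>\<close> is the Legendre symbol, and for both values of \<open>n\<close>
  this gives \<open>4 D\<^sub>n(1, x) = 1 + u + 2 u \<chi>(u)\<close> modulo \<open>p\<close>. Hence \<open>D\<^sub>n\<close> sends \<open>u\<close> to \<open>-3 u\<close> if \<open>u\<close> is a
  nonzero square and fixes all other elements. As \<open>-3\<close> is a square modulo \<open>p\<close>, the \<open>(p - 1) / 2\<close> nonzero
  squares are permuted, in cycles whose length is the order of \<open>-3\<close>.
\<close>

section \<open>Powers of 1 + s through the shift of sequences\<close>

text \<open>
  To stay within the integers, the powers of a possibly irrational \<open>s\<close> are replaced by the sequence of
  the rational parts of \<open>s\<^sup>k\<close>; multiplication by \<open>s\<close> becomes the shift of sequences.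
\<close>

definition one_plus_shift :: "(nat \<Rightarrow> int) \<Rightarrow> nat \<Rightarrow> int" where
  "one_plus_shift f k = f k + f (Suc k)"

text \<open>This is the binomial theorem for the operator 1 + E, where E is the shift; Pascal's rule
  gives the induction step.\<close>

lemma one_plus_shift_funpow:
  "(one_plus_shift ^^ n) f k = (\<Sum>i\<le>n. int (n choose i) * f (k + i))"
proof (induction n arbitrary: k)
  case (Suc n)
  have "(\<Sum>i\<le>Suc n. int (Suc n choose i) * f (k + i))
      = f k + (\<Sum>i\<le>n. int (Suc n choose Suc i) * f (k + Suc i))"
    by (simp add: sum.atMost_Suc_shift del: sum.atMost_Suc)
  also have "\<dots> = (f k + (\<Sum>i\<le>n. int (n choose Suc i) * f (k + Suc i)))
      + (\<Sum>i\<le>n. int (n choose i) * f (Suc k + i))"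
    by (simp add: algebra_simps sum.distrib)
  also have "f k + (\<Sum>i\<le>n. int (n choose Suc i) * f (k + Suc i))
      = (\<Sum>i\<le>Suc n. int (n choose i) * f (k + i))"
    by (simp add: sum.atMost_Suc_shift del: sum.atMost_Suc)
  finally have "(\<Sum>i\<le>Suc n. int (Suc n choose i) * f (k + i))
      = (one_plus_shift ^^ n) f k + (one_plus_shift ^^ n) f (Suc k)"
    by (simp add: Suc.IH)
  then show ?case
    by (simp only: funpow.simps comp_apply one_plus_shift_def[of "(one_plus_shift ^^ n) f"])
qed simp

text \<open>All inner binomial coefficients are divisible by p, so (1 + E)^p acts as 1 + E^p modulo
  p. This is Frobenius for the shift; as f is arbitrary, it can be iterated.\<close>

lemma one_plus_shift_prime_cong:
  assumes "prime p"
  shows "[(one_plus_shift ^^ p) f k = f k + f (k + p)] (mod int p)"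
proof -
  have p: "p > 0" using assms by (rule prime_gt_0_nat)
  have "int p dvd int (p choose i) * f (k + i)" if "i \<in> {..p} - {0, p}" for i
  proof -
    from that have "p dvd (p choose i)"
      using assms by (intro dvd_choose_prime) auto
    then show ?thesis by simp
  qed
  then have "int p dvd (\<Sum>i\<in>{..p} - {0, p}. int (p choose i) * f (k + i))"
    by (intro dvd_sum)
  moreover have "(one_plus_shift ^^ p) f k - (f k + f (k + p))
      = (\<Sum>i\<in>{..p} - {0, p}. int (p choose i) * f (k + i))"
    using p by (simp add: one_plus_shift_funpow sum_diff)
  ultimately show ?thesis
    by (simp add: cong_iff_dvd_diff)
qed

text \<open>Odd powers of s are integer multiples of s and have rational part 0. The value is also
  the average of s^k and (-s)^k, which makes sense even if u is a square.\<close>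

definition sqrt_power :: "int \<Rightarrow> nat \<Rightarrow> int" where
  "sqrt_power u k = (if even k then u ^ (k div 2) else 0)"

text \<open>On the powers of s the operator E^2 is multiplication by u, and both commute with 1 +
  E.\<close>

lemma one_plus_shift_sqrt_power_add_2:
  "(one_plus_shift ^^ n) (sqrt_power u) (Suc (Suc k)) = u * (one_plus_shift ^^ n) (sqrt_power u) k"
proof (induction n arbitrary: k)
  case 0
  show ?case by (simp add: sqrt_power_def)
next
  case (Suc n)
  then show ?case by (simp add: one_plus_shift_def algebra_simps)
qed

text \<open>Since (1 + s)^n and (1 - s)^n are conjugate, their sum is twice the rational part of (1
  + s)^n. The recurrence matches (1 + E)^2 = 2 (1 + E) - (1 - u), where 1 - u = 4 x.\<close>

lemma rev_dickson_binet:
  "2 ^ n * poly (rev_dickson n) x = 2 * (one_plus_shift ^^ n) (sqrt_power (1 - 4 * x)) 0"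
proof (induction n rule: rev_dickson.induct)
  case (3 n)
  define g where "g = (one_plus_shift ^^ n) (sqrt_power (1 - 4 * x))"
  have "2 ^ Suc (Suc n) * poly (rev_dickson (Suc (Suc n))) x
      = 2 * (2 ^ Suc n * poly (rev_dickson (Suc n)) x) - 4 * x * (2 ^ n * poly (rev_dickson n) x)"
    by (simp add: algebra_simps)
  also have "\<dots> = 2 * (2 * one_plus_shift g 0) - 4 * x * (2 * g 0)"
    by (simp only: 3) (simp add: g_def)
  also have "\<dots> = 2 * one_plus_shift (one_plus_shift g) 0"
  proof -
    have "g (Suc (Suc 0)) = (1 - 4 * x) * g 0"
      unfolding g_def by (rule one_plus_shift_sqrt_power_add_2)
    then show ?thesis by (simp add: one_plus_shift_def algebra_simps)
  qed
  finally show ?case by (simp add: g_def)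
qed (simp_all add: one_plus_shift_def sqrt_power_def)

section \<open>Orders and Fermat's theorem for integer bases\<close>

text \<open>The base -3 is negative, while \<open>ord_divides\<close> and
  \<open>fermat_theorem\<close> are applied to natural numbers; passing to the reduced
  representative carries both over.\<close>

lemma cong_nat_mod_power_eq_1_iff:
  assumes "n > 0"
  shows "[nat (a mod int n) ^ d = 1] (mod n) \<longleftrightarrow> [a ^ d = 1] (mod int n)"
proof -
  have "[nat (a mod int n) ^ d = 1] (mod n) \<longleftrightarrow> [(a mod int n) ^ d = 1] (mod int n)"
    using assms cong_int_iff[of "nat (a mod int n) ^ d" 1 n] by simp
  then show ?thesis by (simp add: cong_def power_mod)
qed

lemma ord_int_eq_ord_nat:
  assumes "n > 0"
  shows "ord (int n) a = ord n (nat (a mod int n))"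
proof -
  have "coprime (int n) (int (nat (a mod int n))) \<longleftrightarrow> coprime (int n) a"
    using assms by simp
  then have "coprime n (nat (a mod int n)) \<longleftrightarrow> coprime (int n) a"
    by (simp only: coprime_int_iff)
  then show ?thesis
    by (simp only: ord_def cong_nat_mod_power_eq_1_iff[OF assms])
qed

lemma ord_int_divides:
  assumes "n > 0"
  shows "[a ^ d = 1] (mod int n) \<longleftrightarrow> ord (int n) a dvd d"
  by (simp only: ord_int_eq_ord_nat[OF assms] ord_divides[symmetric] cong_nat_mod_power_eq_1_iff[OF assms])

lemma cong_power_prime_int:
  assumes "prime p"
  shows "[a ^ p = a] (mod int p)"
proof (cases "int p dvd a")
  case True
  have "p > 0" using assms by (rule prime_gt_0_nat)
  then have "a dvd a ^ p" by (simp add: dvd_power)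
  then show ?thesis
    using True unfolding cong_iff_dvd_diff by (meson dvd_diff dvd_trans)
next
  case False
  have p: "p > 0" using assms by (rule prime_gt_0_nat)
  have "\<not> p dvd nat (a mod int p)"
    using False p int_dvd_int_iff[of p "nat (a mod int p)"] by (simp add: dvd_mod_iff)
  then have "[nat (a mod int p) ^ (p - 1) = 1] (mod p)"
    using fermat_theorem assms by blast
  then have "[a ^ (p - 1) = 1] (mod int p)"
    by (simp only: cong_nat_mod_power_eq_1_iff[OF p])
  then have "[a * a ^ (p - 1) = a * 1] (mod int p)" by (rule cong_scalar_left)
  then show ?thesis
    using p by (simp flip: power_Suc)
qed

section \<open>The map induced by the reversed Dickson polynomials\<close>

text \<open>Modulo p, (1 + E)^(p+2) becomes (1 + E^p) (1 + E)^2, and (1 + E)^(2p+1) becomes (1 +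
  E^p)^2 (1 + E). At index 0 only even powers of E survive: 1, 2 E^(p+1), and E^2 or E^(2p). The
  latter two agree by Fermat, and Euler's criterion evaluates u^((p+1)/2).\<close>

lemma rev_dickson_cong_Legendre:
  assumes "prime p" "odd p" "n \<in> {p + 2, 2 * p + 1}"
  shows "[4 * poly (rev_dickson n) x =
    1 + (1 - 4 * x) + 2 * ((1 - 4 * x) * Legendre (1 - 4 * x) (int p))] (mod int p)"
proof -
  define u where "u = 1 - 4 * x"
  have p: "p > 2" using assms prime_ge_2_nat[of p] by (cases "p = 2") auto
  have u: "[2 * u ^ ((p + 1) div 2) = 2 * (u * Legendre u (int p))] (mod int p)"
  proof -
    have "(p + 1) div 2 = Suc ((p - 1) div 2)" using p \<open>odd p\<close> by presburger
    then show ?thesis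
      using euler_criterion[OF assms(1) p, of u]
      by (auto intro!: cong_scalar_left intro: cong_sym)
  qed
  have two: "[2 ^ p = 2] (mod int p)"
    using assms(1) by (rule cong_power_prime_int)
  have coprime: "coprime (2 :: int) (int p)" using \<open>odd p\<close> by simp
  have T: "[(one_plus_shift ^^ p) f k = f k + f (k + p)] (mod int p)" for f k
    using assms(1) by (rule one_plus_shift_prime_cong)
  let ?c = "sqrt_power u"
  have binet: "2 ^ n * poly (rev_dickson n) x = 2 * (one_plus_shift ^^ n) ?c 0"
    unfolding u_def by (rule rev_dickson_binet)
  have "[4 * poly (rev_dickson n) x = 1 + u + 2 * u ^ ((p + 1) div 2)] (mod int p)"
  proof (cases "n = p + 2")
    case True
    let ?g = "one_plus_shift (one_plus_shift ?c)"
    have "(one_plus_shift ^^ n) ?c 0 = (one_plus_shift ^^ p) ?g 0"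
      unfolding True funpow_add by (simp add: numeral_2_eq_2)
    also have "[\<dots> = ?g 0 + ?g p] (mod int p)"
      using T[of ?g 0] by simp
    also have "?g 0 + ?g p = 1 + u + 2 * u ^ ((p + 1) div 2)"
      using \<open>odd p\<close> by (simp add: one_plus_shift_def sqrt_power_def)
    finally have A: "[2 * (one_plus_shift ^^ n) ?c 0 = 2 * (1 + u + 2 * u ^ ((p + 1) div 2))] (mod int p)"
      by (rule cong_scalar_left)
    \<comment> \<open>As 2^n = 4 * 2^p and 2^p is congruent to 2, both sides acquire a common factor
      2, which the odd modulus allows to cancel.\<close>
    have "[2 ^ p * (4 * poly (rev_dickson n) x) = 2 * (4 * poly (rev_dickson n) x)] (mod int p)"
      using two by (rule cong_scalar_right)
    moreover have "2 ^ p * (4 * poly (rev_dickson n) x) = 2 ^ n * poly (rev_dickson n) x"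
      by (simp add: True power_add)
    ultimately have "[2 * (4 * poly (rev_dickson n) x) = 2 * (1 + u + 2 * u ^ ((p + 1) div 2))] (mod int p)"
      using A binet by (metis cong_sym cong_trans)
    then show ?thesis by (simp only: cong_mult_lcancel[OF coprime])
  next
    case False
    then have n: "n = p + (p + 1)" using assms by auto
    let ?g = "one_plus_shift ?c"
    have "(one_plus_shift ^^ n) ?c 0 = (one_plus_shift ^^ p) ((one_plus_shift ^^ p) ?g) 0"
      unfolding n funpow_add by simp
    \<comment> \<open>Frobenius is applied to the outer p-th power first, then to the inner one at
      the indices 0 and p.\<close>
    also have "[\<dots> = (one_plus_shift ^^ p) ?g 0 + (one_plus_shift ^^ p) ?g p] (mod int p)"
      using T[of "(one_plus_shift ^^ p) ?g" 0] by simp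
    also have "[(one_plus_shift ^^ p) ?g 0 + (one_plus_shift ^^ p) ?g p
        = (?g 0 + ?g p) + (?g p + ?g (p + p))] (mod int p)"
      by (rule cong_add[OF T[of ?g 0, unfolded add_0] T])
    also have "(?g 0 + ?g p) + (?g p + ?g (p + p)) = 1 + u ^ p + 2 * u ^ ((p + 1) div 2)"
      using \<open>odd p\<close> by (simp add: one_plus_shift_def sqrt_power_def)
    also have "[\<dots> = 1 + u + 2 * u ^ ((p + 1) div 2)] (mod int p)"
      by (intro cong_add cong_power_prime_int assms) auto
    finally have A: "[2 * (one_plus_shift ^^ n) ?c 0 = 2 * (1 + u + 2 * u ^ ((p + 1) div 2))] (mod int p)"
      by (rule cong_scalar_left)
    \<comment> \<open>Here 2^n = 2^p * 2^p * 2, so two powers 2^p are replaced by 2.\<close>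
    have "[(2 ^ p * 2 ^ p) * (2 * poly (rev_dickson n) x) = (2 * 2) * (2 * poly (rev_dickson n) x)] (mod int p)"
      by (intro cong_mult two cong_refl)
    moreover have "(2 ^ p * 2 ^ p) * (2 * poly (rev_dickson n) x) = 2 ^ n * poly (rev_dickson n) x"
      by (simp add: n power_add)
    ultimately have "[(2 * 2) * (2 * poly (rev_dickson n) x) = 2 * (1 + u + 2 * u ^ ((p + 1) div 2))] (mod int p)"
      using A binet by (metis cong_sym cong_trans)
    then have "[2 * (4 * poly (rev_dickson n) x) = 2 * (1 + u + 2 * u ^ ((p + 1) div 2))] (mod int p)"
      by simp
    then show ?thesis by (simp only: cong_mult_lcancel[OF coprime])
  qed
  also have "[1 + u + 2 * u ^ ((p + 1) div 2) = 1 + u + 2 * (u * Legendre u (int p))] (mod int p)"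
    using u by (intro cong_add cong_refl)
  finally show ?thesis by (simp add: u_def)
qed

lemma poly_map_poly_mod_cong:
  "[poly (map_poly (\<lambda>c. c mod m) f) x = poly f x] (mod (m :: int))"
proof (induction f)
  case (pCons a f)
  have "map_poly (\<lambda>c. c mod m) (pCons a f) = pCons (a mod m) (map_poly (\<lambda>c. c mod m) f)"
    by (simp add: map_poly_pCons)
  then show ?case
    using pCons.IH by (auto intro!: cong_add cong_scalar_left)
qed simp

text \<open>For Legendre symbol 1 the right-hand side is 1 + 3 u = 4 (1 - 3 x); for symbol -1 it is
  1 - u = 4 x. The factor 4 is invertible modulo the odd prime p.\<close>

lemma induced_map_rev_dickson:
  assumes "prime p" "odd p" "n \<in> {p + 2, 2 * p + 1}"
  shows "induced_map p (rev_dickson n) x =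
    (if Legendre (1 - 4 * x) (int p) = 1 then 1 - 3 * x else x) mod int p"
proof -
  define u where "u = 1 - 4 * x"
  let ?h = "if Legendre u (int p) = 1 then 1 - 3 * x else x"
  have coprime: "coprime (4 :: int) (int p)"
    using \<open>odd p\<close> coprime_power_left_iff[of "2::int" 2 "int p"] by simp
  have *: "[4 * poly (rev_dickson n) x = 1 + u + 2 * (u * Legendre u (int p))] (mod int p)"
    unfolding u_def using assms by (rule rev_dickson_cong_Legendre)
  have "[1 + u + 2 * (u * Legendre u (int p)) = 4 * ?h] (mod int p)"
  proof -
    consider "Legendre u (int p) = 1" | "Legendre u (int p) = 0" "[u = 0] (mod int p)"
      | "Legendre u (int p) = -1"
      unfolding Legendre_def by presburger
    then show ?thesis
    proof cases
      \<comment> \<open>The value 1 + u differs from 4 x = 1 - u by 2 u, a multiple of p.\<close>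
      case 2
      then have "int p dvd 2 * u" by (simp add: cong_0_iff)
      then show ?thesis using 2 by (simp add: cong_iff_dvd_diff u_def)
    qed (simp_all add: u_def)
  qed
  with * have "[4 * poly (rev_dickson n) x = 4 * ?h] (mod int p)"
    by (rule cong_trans)
  then have "[poly (rev_dickson n) x = ?h] (mod int p)"
    using coprime by (simp add: cong_mult_lcancel)
  then have "[poly (map_poly (\<lambda>c. c mod int p) (rev_dickson n)) x = ?h] (mod int p)"
    using poly_map_poly_mod_cong cong_trans by blast
  then show ?thesis
    by (simp add: induced_map_def cong_def u_def)
qed

section \<open>Quadratic residues: their number, and -3 among them\<close>

text \<open>A nonzero square has exactly two roots, y and -y, one of which is represented in the
  lower half 1, ..., (p - 1)/2.\<close>

lemma card_Legendre_eq_1: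
  assumes "prime p" "odd p"
  shows "card {u \<in> {0..int p - 1}. Legendre u (int p) = 1} = (p - 1) div 2"
proof -
  have p: "p > 2" using assms prime_ge_2_nat[of p] by (cases "p = 2") auto
  have prime: "prime (int p)" using assms by simp
  let ?Y = "{1..(int p - 1) div 2}"
  have inj: "inj_on (\<lambda>y. y\<^sup>2 mod int p) ?Y"
  proof (rule inj_onI)
    fix y z assume yz: "y \<in> ?Y" "z \<in> ?Y" and "y\<^sup>2 mod int p = z\<^sup>2 mod int p"
    then have "int p dvd y\<^sup>2 - z\<^sup>2" by (simp add: mod_eq_dvd_iff)
    then have "int p dvd (y + z) * (y - z)" by (simp add: power2_eq_square algebra_simps)
    \<comment> \<open>Both summands are at most (p - 1)/2, so 0 < y + z < p.\<close>
    moreover have "\<not> int p dvd y + z" using yz by (intro zdvd_not_zless) auto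
    ultimately have "int p dvd y - z" using prime prime_dvd_mult_iff by blast
    then have "y mod int p = z mod int p" by (simp add: mod_eq_dvd_iff)
    then show "y = z" using yz by auto
  qed
  have "{u \<in> {0..int p - 1}. Legendre u (int p) = 1} = (\<lambda>y. y\<^sup>2 mod int p) ` ?Y" (is "?L = ?R")
  proof (intro equalityI subsetI)
    fix u assume u: "u \<in> ?L"
    then obtain y where y: "[y\<^sup>2 = u] (mod int p)" and u0: "\<not> [u = 0] (mod int p)"
      by (auto simp: Legendre_def QuadRes_def split: if_splits)
    define z where "z = y mod int p"
    have z: "0 \<le> z" "z < int p" using p by (simp_all add: z_def)
    have zu: "z\<^sup>2 mod int p = u"
      using y u by (simp add: z_def power_mod cong_def)
    then have "z \<noteq> 0" using u0 by auto
    show "u \<in> ?R"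
    proof (cases "z \<le> (int p - 1) div 2")
      case True
      then show ?thesis using z zu \<open>z \<noteq> 0\<close> by auto
    next
      case False
      \<comment> \<open>A root in the upper half is replaced by its negative.\<close>
      have "(int p - z)\<^sup>2 = z\<^sup>2 + int p * (int p - 2 * z)"
        by (simp add: power2_eq_square algebra_simps)
      then have "u = (int p - z)\<^sup>2 mod int p" using zu by simp
      moreover have "int p - z \<in> ?Y"
      proof -
        from \<open>odd p\<close> obtain q where "p = 2 * q + 1" by (rule oddE)
        then show ?thesis using False z by auto
      qed
      ultimately show ?thesis by blast
    qed
  next
    fix u assume "u \<in> ?R"
    then obtain y where y: "y \<in> ?Y" and u: "u = y\<^sup>2 mod int p" by blast
    have "\<not> int p dvd y" using y by (intro zdvd_not_zless) auto
    then have "\<not> int p dvd y\<^sup>2" using prime prime_dvd_power by blast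
    then have "\<not> [u = 0] (mod int p)" by (simp add: u cong_0_iff dvd_mod_iff)
    moreover have "QuadRes (int p) u" unfolding QuadRes_def by (rule exI[of _ y]) (simp add: u)
    ultimately show "u \<in> ?L"
      using p by (simp add: u Legendre_def)
  qed
  then have "card ?L = card ?Y" using inj by (simp add: card_image)
  also have "\<dots> = (p - 1) div 2" using p by simp
  finally show ?thesis .
qed

text \<open>A primitive root g yields a nontrivial cube root of unity z = g^((p-1)/3). It is a root
  of z^2 + z + 1, whose discriminant is -3, so completing the square gives (2 z + 1)^2 = -3 modulo
  p.\<close>

lemma QuadRes_neg_3:
  assumes "prime p" "p mod 3 = 1"
  shows "QuadRes (int p) (- 3)"
proof -
  have p: "p > 1" using assms(1) by (rule prime_gt_1_nat)
  obtain g where g: "residue_primroot p g"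
    using prime_primitive_root_exists[OF p assms(1)] by blast
  then have ord_g: "ord p g = p - 1"
    using assms(1) by (simp add: residue_primroot_def totient_prime)
  define z where "z = int g ^ ((p - 1) div 3)"
  have dvd3: "(p - 1) div 3 * 3 = p - 1" using assms(2) p by presburger
  then have "\<not> p - 1 dvd (p - 1) div 3"
    using p by (intro nat_dvd_not_less) auto
  then have "\<not> [g ^ ((p - 1) div 3) = 1] (mod p)"
    by (simp only: ord_divides ord_g not_False_eq_True)
  then have "\<not> [z = 1] (mod int p)"
    using cong_int_iff[of "g ^ ((p - 1) div 3)" 1 p] by (simp add: z_def)
  then have z1: "\<not> int p dvd z - 1" by (simp add: cong_iff_dvd_diff)
  have "[g ^ (p - 1) = 1] (mod p)" using ord_g ord_divides[of g "p - 1" p] by simp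
  then have "[z ^ 3 = 1] (mod int p)"
    using cong_int_iff[of "g ^ (p - 1)" 1 p] dvd3 by (simp add: z_def flip: power_mult)
  moreover have "z ^ 3 - 1 = (z - 1) * (z\<^sup>2 + z + 1)"
    by (simp add: power2_eq_square power3_eq_cube algebra_simps)
  ultimately have "int p dvd z\<^sup>2 + z + 1"
    using z1 assms(1) by (metis cong_iff_dvd_diff prime_dvd_mult_iff prime_nat_int_transfer)
  then have "int p dvd 4 * (z\<^sup>2 + z + 1)" by (rule dvd_mult)
  moreover have "4 * (z\<^sup>2 + z + 1) = (2 * z + 1)\<^sup>2 - (- 3)"
    by (simp add: power2_eq_square algebra_simps)
  ultimately show ?thesis
    unfolding QuadRes_def cong_iff_dvd_diff by metis
qed

section \<open>Cycle type of a map whose nontrivial cycles have equal length\<close>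

text \<open>The m-th iterate is the identity on S, so f is injective on a finite set and hence
  bijective. The period condition gives every orbit in Q exactly m elements, and the orbits
  partition Q.\<close>

lemma bij_betw_cycle_type_uniform:
  assumes "finite S" "Q \<subseteq> S" "m > 0"
    and maps: "f ` Q \<subseteq> Q"
    and fixed: "\<And>x. x \<in> S - Q \<Longrightarrow> f x = x"
    and period: "\<And>x k. x \<in> Q \<Longrightarrow> (f ^^ k) x = x \<longleftrightarrow> m dvd k"
  shows "bij_betw f S S"
    and "cycle_type f S = replicate_mset (card Q div m) m + replicate_mset (card (S - Q)) 1"
proof -
  have fin: "finite Q" using assms finite_subset by blast
  have funpow_Q: "(f ^^ k) x \<in> Q" if "x \<in> Q" for k x
    using that maps by (induction k) auto
  have funpow_m: "(f ^^ m) x = x" if "x \<in> S" for x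
  proof (cases "x \<in> Q")
    case False
    then have "f x = x" using that fixed by blast
    then show ?thesis by (induction m) auto
  qed (simp add: period)
  have "inj_on f S"
  proof (rule inj_onI)
    fix x y assume xy: "x \<in> S" "y \<in> S" "f x = f y"
    \<comment> \<open>Applying f another m - 1 times to f x = f y reaches the m-th iterates.\<close>
    have "(f ^^ m) x = (f ^^ m) y"
      using xy \<open>m > 0\<close> by (cases m) (simp_all add: funpow_swap1)
    then show "x = y" using xy funpow_m by simp
  qed
  moreover have "f ` S \<subseteq> S" using maps fixed \<open>Q \<subseteq> S\<close> by (metis Diff_iff image_subset_iff subset_iff)
  ultimately show "bij_betw f S S"
    using \<open>finite S\<close> by (simp add: bij_betw_def endo_inj_surj)

  \<comment> \<open>\<open>orbit f x\<close> collects iterates with positive exponent only, so x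
    enters as its own m-th iterate.\<close>
  have self: "x \<in> orbit f x" if "x \<in> Q" for x
    using that period[of x m] \<open>m > 0\<close> unfolding orbit_altdef by (auto intro!: exI[of _ m])
  have orbit_subset_Q: "orbit f x \<subseteq> Q" if "x \<in> Q" for x
    using funpow_Q[OF that] by (auto simp: orbit_altdef)
  have card_orbit: "card (orbit f x) = m" if x: "x \<in> Q" for x
  proof -
    have "orbit f x = (\<lambda>k. (f ^^ k) x) ` {..<m}"
      using orbit_altdef_bounded[of m f x] x period \<open>m > 0\<close> by auto
    moreover have "inj_on (\<lambda>k. (f ^^ k) x) {..<m}"
    proof (rule linorder_inj_onI)
      fix a b assume ab: "a < b" "a \<in> {..<m}" "b \<in> {..<m}"
      show "(f ^^ a) x \<noteq> (f ^^ b) x"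
      proof
        assume "(f ^^ a) x = (f ^^ b) x"
        \<comment> \<open>A further m - b applications return the right side to x, while the
          exponent m - b + a on the left lies strictly between 0 and m.\<close>
        then have "(f ^^ (m - b + a)) x = (f ^^ (m - b + b)) x"
          by (simp only: funpow_add comp_apply)
        also have "\<dots> = x" using ab x period[of x m] by simp
        finally have "m dvd m - b + a" using x period by simp
        then show False using ab by (auto dest: dvd_imp_le)
      qed
    qed auto
    ultimately show ?thesis by (simp add: card_image)
  qed
  have orbit_eq: "orbit f y = orbit f x" if "x \<in> Q" "y \<in> orbit f x" for x y
    using that self orbit_swap orbit_trans by (metis subsetI subset_antisym)
  have "m * card (orbit f ` Q) = card (\<Union> (orbit f ` Q))"
  proof (rule card_partition)
    show "finite (\<Union> (orbit f ` Q))"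
      using orbit_subset_Q fin by (meson UN_least finite_subset)
    show "A \<inter> B = {}" if "A \<in> orbit f ` Q" "B \<in> orbit f ` Q" "A \<noteq> B" for A B
      using that orbit_eq by blast
  qed (use fin card_orbit in auto)
  also have "\<Union> (orbit f ` Q) = Q"
    using self orbit_subset_Q by blast
  finally have "card Q = m * card (orbit f ` Q)" ..
  then have card_orbits: "card (orbit f ` Q) = card Q div m"
    using \<open>m > 0\<close> by simp

  have fixed_orbits: "orbit f ` (S - Q) = (\<lambda>x. {x}) ` (S - Q)"
    using fixed by (intro image_cong) (simp_all add: orbit_eq_singleton_iff)
  have "orbit f ` S = orbit f ` Q \<union> (\<lambda>x. {x}) ` (S - Q)"
    using \<open>Q \<subseteq> S\<close> fixed_orbits by (metis Un_Diff_cancel image_Un sup.absorb2)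
  \<comment> \<open>Without this disjointness the set of orbits could merge cycles and the multiset
    would not split as a sum.\<close>
  moreover have "orbit f ` Q \<inter> (\<lambda>x. {x}) ` (S - Q) = {}"
    using orbit_subset_Q by blast
  ultimately have "mset_set (orbit f ` S)
      = mset_set (orbit f ` Q) + mset_set ((\<lambda>x. {x}) ` (S - Q))"
    using fin \<open>finite S\<close> by (simp add: mset_set_Union)
  moreover have "image_mset card (mset_set (orbit f ` Q)) = replicate_mset (card Q div m) m"
  proof -
    have "image_mset card (mset_set (orbit f ` Q)) = image_mset (\<lambda>_. m) (mset_set (orbit f ` Q))"
      using fin by (intro image_mset_cong) (auto simp: card_orbit)
    then show ?thesis by (simp add: image_mset_const_eq card_orbits)
  qed
  moreover have "image_mset card (mset_set ((\<lambda>x. {x}) ` (S - Q))) = replicate_mset (card (S - Q)) 1"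
    by (simp add: multiset.map_comp comp_def image_mset_const_eq flip: image_mset_mset_set)
  ultimately show "cycle_type f S = replicate_mset (card Q div m) m + replicate_mset (card (S - Q)) 1"
    by (simp add: cycle_type_def)
qed

section \<open>Legendre symbols of congruent arguments and of products\<close>

lemma Legendre_cong:
  assumes "[a = b] (mod m)"
  shows "Legendre a m = Legendre b m"
proof -
  have "[a = c] (mod m) \<longleftrightarrow> [b = c] (mod m)" "[c = a] (mod m) \<longleftrightarrow> [c = b] (mod m)" for c
    using assms by (auto simp: cong_def)
  then show ?thesis by (simp add: Legendre_def QuadRes_def)
qed

lemma Legendre_mult_QuadRes:
  assumes "prime (p :: int)" "QuadRes p a" "\<not> p dvd a" "Legendre b p = 1"
  shows "Legendre (a * b) p = 1"
proof -
  from assms obtain y z where "[y\<^sup>2 = a] (mod p)" "[z\<^sup>2 = b] (mod p)" and "\<not> p dvd b"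
    by (auto simp: Legendre_def QuadRes_def cong_0_iff split: if_splits)
  then have "[(y * z)\<^sup>2 = a * b] (mod p)"
    by (simp add: power_mult_distrib cong_mult)
  moreover have "\<not> p dvd a * b"
    using assms \<open>\<not> p dvd b\<close> by (simp add: prime_dvd_mult_iff)
  ultimately show ?thesis
    by (auto simp: Legendre_def QuadRes_def cong_0_iff)
qed

section \<open>Cycle type of the induced permutations\<close>

theorem theorem3p13:
  fixes p j :: nat
  assumes "prime p"
    and "p mod 12 = 1 \<or> p mod 12 = 7"
    and "j > 0"
    and "j dvd p - 1"
    and "ord (int p) (- 3) = (p - 1) div j"
  shows "\<forall>n \<in> {p + 2, 2 * p + 1}.
           bij_betw (induced_map p (rev_dickson n))
             (carrier (residue_ring (int p))) (carrier (residue_ring (int p))) \<and>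
           cycle_type (induced_map p (rev_dickson n)) (carrier (residue_ring (int p))) =
             replicate_mset (j div 2) ((p - 1) div j) + replicate_mset ((p + 1) div 2) 1"
proof
  fix n assume n: "n \<in> {p + 2, 2 * p + 1}"
  define f where "f = induced_map p (rev_dickson n)"
  define S where "S = {0..int p - 1}"
  define Q where "Q = {x \<in> S. Legendre (1 - 4 * x) (int p) = 1}"
  define m where "m = (p - 1) div j"
  have prime: "prime (int p)" using assms(1) by simp
  have p: "p \<ge> 7" "odd p" "p mod 3 = 1"
  proof -
    show "p mod 3 = 1" using assms(2) by presburger
    show "odd p" using assms(2) by presburger
    have "p \<noteq> 1" using assms(1) by auto
    then show "p \<ge> 7" using assms(2) by presburger
  qed
  have m: "j * m = p - 1" using assms(4) by (simp add: m_def)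
  then have "m > 0" using p by (cases m) auto
  have neg_3: "\<not> int p dvd - 3"
    using p by (auto dest: zdvd_imp_le)
  have coprime: "coprime (4 :: int) (int p)"
    using \<open>odd p\<close> coprime_power_left_iff[of "2::int" 2 "int p"] by simp
  have f: "f x = (if Legendre (1 - 4 * x) (int p) = 1 then 1 - 3 * x else x) mod int p" for x
    unfolding f_def using assms(1) p(2) n by (rule induced_map_rev_dickson)

  have f_Q: "[1 - 4 * f x = - 3 * (1 - 4 * x)] (mod int p)" if "x \<in> Q" for x
  proof -
    have "[f x = 1 - 3 * x] (mod int p)" using that by (simp add: f Q_def cong_def)
    then have "[1 - 4 * f x = 1 - 4 * (1 - 3 * x)] (mod int p)"
      by (intro cong_diff cong_scalar_left cong_refl)
    then show ?thesis by (simp add: algebra_simps)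
  qed
  have maps: "f x \<in> Q" if "x \<in> Q" for x
  proof -
    have "Legendre (- 3 * (1 - 4 * x)) (int p) = 1"
      using that prime neg_3 QuadRes_neg_3[OF assms(1) p(3)]
      by (intro Legendre_mult_QuadRes) (simp_all add: Q_def)
    then have "Legendre (1 - 4 * f x) (int p) = 1"
      using Legendre_cong[OF f_Q[OF that]] by simp
    moreover have "f x \<in> S" using p by (simp add: f S_def)
    ultimately show ?thesis by (simp add: Q_def)
  qed
  have funpow_f: "(f ^^ k) x \<in> Q \<and> [1 - 4 * (f ^^ k) x = (- 3) ^ k * (1 - 4 * x)] (mod int p)"
    if "x \<in> Q" for x k
  proof (induction k)
    case (Suc k)
    have "[1 - 4 * f ((f ^^ k) x) = - 3 * (1 - 4 * (f ^^ k) x)] (mod int p)"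
      using Suc f_Q by blast
    also have "[- 3 * (1 - 4 * (f ^^ k) x) = - 3 * ((- 3) ^ k * (1 - 4 * x))] (mod int p)"
      using Suc by (intro cong_scalar_left) blast
    finally show ?case using Suc maps by (simp add: mult.assoc)
  qed (use that in simp)
  have period: "(f ^^ k) x = x \<longleftrightarrow> m dvd k" if x: "x \<in> Q" for x k
  proof -
    \<comment> \<open>Points of S are reduced representatives, so equality can be tested modulo p.
      In the coordinate u = 1 - 4 x, returning after k steps means (-3)^k u = u, and u is invertible
      for x in Q.\<close>
    have "x \<in> S" "(f ^^ k) x \<in> S"
      using x funpow_f[OF x, of k] by (auto simp: Q_def)
    then have "(f ^^ k) x = x \<longleftrightarrow> [(f ^^ k) x = x] (mod int p)"
      by (simp add: S_def cong_def)
    also have "\<dots> \<longleftrightarrow> [4 * (f ^^ k) x = 4 * x] (mod int p)"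
      using coprime by (simp add: cong_mult_lcancel)
    also have "\<dots> \<longleftrightarrow> [1 - 4 * (f ^^ k) x = 1 - 4 * x] (mod int p)"
      by (simp add: cong_iff_dvd_diff) (simp add: dvd_diff_commute)
    also have "\<dots> \<longleftrightarrow> [(- 3) ^ k * (1 - 4 * x) = 1 * (1 - 4 * x)] (mod int p)"
      using funpow_f[OF x, of k] by (simp add: cong_def)
    also have "\<dots> \<longleftrightarrow> [(- 3) ^ k = 1] (mod int p)"
    proof -
      have "\<not> int p dvd 1 - 4 * x"
        using x by (auto simp: Q_def Legendre_def cong_0_iff)
      then have "coprime (1 - 4 * x) (int p)"
        using prime prime_imp_coprime coprime_commute by blast
      then show ?thesis by (rule cong_mult_rcancel)
    qed
    also have "\<dots> \<longleftrightarrow> m dvd k"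
      using p by (simp only: ord_int_divides assms(5) m_def)
    finally show ?thesis .
  qed
  have fixed: "f x = x" if "x \<in> S - Q" for x
    using that by (simp add: f S_def Q_def)

  have card_Q: "card Q = (p - 1) div 2"
  proof -
    \<comment> \<open>As 4 is invertible modulo p, this change of coordinate permutes S; it carries
      Q onto the nonzero squares.\<close>
    let ?g = "\<lambda>x. (1 - 4 * x) mod int p"
    have inj: "inj_on ?g S"
    proof (rule inj_onI)
      fix x y assume xy: "x \<in> S" "y \<in> S" "?g x = ?g y"
      then have "[4 * x = 4 * y] (mod int p)"
        by (simp add: mod_eq_dvd_iff cong_iff_dvd_diff) (simp add: dvd_diff_commute)
      then have "[x = y] (mod int p)" using coprime by (simp add: cong_mult_lcancel)
      then show "x = y" using xy by (simp add: S_def cong_def)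
    qed
    have "?g ` S \<subseteq> S" using p by (auto simp: S_def)
    then have surj: "?g ` S = S" using inj by (intro endo_inj_surj) (simp_all add: S_def)
    have Leg: "Legendre (?g x) (int p) = Legendre (1 - 4 * x) (int p)" for x
      by (rule Legendre_cong) (simp add: cong_def)
    have "?g ` Q = {u \<in> S. Legendre u (int p) = 1}"
    proof (intro equalityI subsetI)
      fix u assume "u \<in> {u \<in> S. Legendre u (int p) = 1}"
      then obtain x where "x \<in> S" "u = ?g x" "Legendre u (int p) = 1" using surj by blast
      then show "u \<in> ?g ` Q" using Leg by (auto simp: Q_def)
    qed (use surj Leg in \<open>auto simp: Q_def\<close>)
    moreover have "inj_on ?g Q" using inj by (rule inj_on_subset) (simp add: Q_def)
    ultimately have "card Q = card {u \<in> S. Legendre u (int p) = 1}"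
      by (metis card_image)
    then show ?thesis
      unfolding S_def using card_Legendre_eq_1[OF assms(1) p(2)] by simp
  qed
  have "Q \<subseteq> S" by (simp add: Q_def)
  have card_fixed: "card (S - Q) = (p + 1) div 2"
  proof -
    have "finite Q" using \<open>Q \<subseteq> S\<close> by (rule finite_subset) (simp add: S_def)
    then have "card (S - Q) = p - (p - 1) div 2"
      using \<open>Q \<subseteq> S\<close> card_Q by (simp add: S_def card_Diff_subset)
    also have "\<dots> = (p + 1) div 2" using p(2) by presburger
    finally show ?thesis .
  qed
  have card_orbits: "card Q div m = j div 2"
  proof -
    \<comment> \<open>Floor divisions by 2 and by m may be exchanged. Nothing is lost by rounding: Q
      is a union of orbits of size m, so m divides (p - 1)/2 and j is even.\<close>
    have "(p - 1) div 2 div m = (p - 1) div m div 2"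
      by (simp only: div_mult2_eq[symmetric] mult.commute)
    also have "(p - 1) div m = j" using \<open>m > 0\<close> by (simp only: m[symmetric] div_mult_self_is_m)
    finally show ?thesis by (simp add: card_Q)
  qed

  have "finite S" by (simp add: S_def)
  have "f ` Q \<subseteq> Q" using maps by blast
  note cycles = bij_betw_cycle_type_uniform[OF \<open>finite S\<close> \<open>Q \<subseteq> S\<close> \<open>m > 0\<close> this fixed period]
  have "carrier (residue_ring (int p)) = S"
    by (simp add: S_def residue_ring_def)
  then show "bij_betw (induced_map p (rev_dickson n))
             (carrier (residue_ring (int p))) (carrier (residue_ring (int p))) \<and>
           cycle_type (induced_map p (rev_dickson n)) (carrier (residue_ring (int p))) =
             replicate_mset (j div 2) ((p - 1) div j) + replicate_mset ((p + 1) div 2) 1"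
    using cycles(1) cycles(2)[unfolded card_orbits card_fixed] by (simp only: f_def m_def)
qed

end
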